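(* Let $H_n$ denote the HOMFLYPT skein module of $n$-braids, i.e. the algebra over $\mathbb{Z}[v^{\pm1},z^{\pm1}]$ generated by $\sigma_1^{\pm1},\dots,\sigma_{n-1}^{\pm1}$ modulo the braid relations and the skein relation $\sigma_i-\sigma_i^{-1}=z$. For $L\in H_3$, let $L_{12}\in H_4$ be its image under $\sigma_i\mapsto\sigma_i$ and $L_{23}\in H_4$ its image under $\sigma_i\mapsto\sigma_{i+1}$. Consider the positive tetrahedron equation in $H_4$ for an element $L\in H_3$: $$L_{12}\,\sigma_3\sigma_2\sigma_1+\sigma_2\sigma_1\,L_{23}\,\sigma_1+\sigma_2\sigma_3\,L_{12}\,\sigma_3+L_{23}\,\sigma_1\sigma_2\sigma_3-\sigma_3\sigma_2\sigma_1\,L_{23}-\sigma_3\,L_{12}\,\sigma_3\sigma_2-\sigma_1\,L_{23}\,\sigma_1\sigma_2-\sigma_1\sigma_2\sigma_3\,L_{12}=0 .$$ This equation has a unique solution (up to a common factor), which is $L=\sigma_2-\sigma_1$.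
   Context: The equation expresses $\sum_{p\in m}\mathrm{sign}(p)L(p)=0$ in the skein module of 4-braids, where $m$ is the oriented meridian of a positive quadruple crossing of four strands (a small loop around the codimension-two stratum of diagrams in which four branches, all of whose pairwise crossings are positive, project to a common point), and $p$ runs over the eight positive triple crossings (Reidemeister III moves) met along $m$. A move $\sigma_1\sigma_2\sigma_1\to\sigma_2\sigma_1\sigma_2$ has sign $+1$ and its inverse has sign $-1$. $L(p)$ is the result of replacing the triple crossing $p$ by a fixed standard element $L$ of the skein module of 3-braids, the fourth strand being added; $\sigma_i(p)$ denotes the result of replacing the triple crossing $p$ by $\sigma_i$, so the solution reads $L(p)=\sigma_2(p)-\sigma_1(p)$. It is called the solution of constant weight.
   Formalization: The uniqueness claim is false as stated, since L=σ1σ2σ1 also solves the equation and is no multiple of σ2−σ1; the formal theorem says the solutions are exactly c(σ2−σ1)+dσ1σ2σ1 with scalars c, d, and that these two elements are linearly independent. *)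

theory Defs
  imports Complex_Main "HOL-Library.Poly_Mapping" "HOL-Library.Product_Plus" "HOL-Library.Numeral_Type"
begin

section \<open>The coefficient ring\<close>

text \<open>
  The Laurent polynomial ring in two variables is the group ring of the free abelian group
  of exponent vectors: the pair \<open>(a, b)\<close> stands for the monomial \<open>v^a z^b\<close>.
\<close>

type_synonym laurent = "(int \<times> int) \<Rightarrow>\<^sub>0 int"

definition z_var :: laurent where
  "z_var = Poly_Mapping.single (0, 1) 1"

section \<open>The free algebra\<close>

text \<open>
  The number of strands is the cardinality of the type parameter. The letter \<open>(i, True)\<close> stands
  for the generator with index \<open>i\<close> and \<open>(i, False)\<close> for its inverse. Words form a monoid under
  concatenation, written additively, because the convolution product of \<^type>\<open>poly_mapping\<close>
  (here: the product of the free associative algebra on the letters) is based on an additive,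
  not necessarily commutative, monoid.
\<close>

typedef (overloaded) ('n::finite) braid_word =
  "{w :: (nat \<times> bool) list. \<forall>l\<in>set w. 1 \<le> fst l \<and> fst l < CARD('n)}"
  morphisms letters Braid_Word
  by (intro exI[of _ "[]"]) simp

setup_lifting type_definition_braid_word

instantiation braid_word :: (finite) monoid_add
begin

lift_definition zero_braid_word :: "'a braid_word" is "[]" by simp

lift_definition plus_braid_word :: "'a braid_word \<Rightarrow> 'a braid_word \<Rightarrow> 'a braid_word" is "(@)"
  by auto

instance by standard (transfer; simp)+

end

type_synonym 'n free_skein = "'n braid_word \<Rightarrow>\<^sub>0 laurent"

text \<open>Letters outside the range \<open>1, \<dots>, n - 1\<close> are not generators; they are sent to the empty word.\<close>

lift_definition letter_word :: "nat \<Rightarrow> bool \<Rightarrow> 'n::finite braid_word" is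
  "\<lambda>i b. if 1 \<le> i \<and> i < CARD('n) then [(i, b)] else []"
  by simp

definition free_gen :: "nat \<Rightarrow> 'n::finite free_skein" where
  "free_gen i = Poly_Mapping.single (letter_word i True) 1"

definition free_gen_inv :: "nat \<Rightarrow> 'n::finite free_skein" where
  "free_gen_inv i = Poly_Mapping.single (letter_word i False) 1"

definition free_scalar :: "laurent \<Rightarrow> 'n::finite free_skein" where
  "free_scalar c = Poly_Mapping.single 0 c"

section \<open>The defining relations and the ideal they generate\<close>

inductive_set skein_relators :: "'n::finite free_skein set" where
  inverse_right: "1 \<le> i \<Longrightarrow> i < CARD('n) \<Longrightarrow>
    (free_gen i * free_gen_inv i - 1 :: 'n free_skein) \<in> skein_relators"
| inverse_left: "1 \<le> i \<Longrightarrow> i < CARD('n) \<Longrightarrow>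
    (free_gen_inv i * free_gen i - 1 :: 'n free_skein) \<in> skein_relators"
| braid: "1 \<le> i \<Longrightarrow> i + 1 < CARD('n) \<Longrightarrow>
    (free_gen i * free_gen (i + 1) * free_gen i
      - free_gen (i + 1) * free_gen i * free_gen (i + 1) :: 'n free_skein) \<in> skein_relators"
| far_commute: "1 \<le> i \<Longrightarrow> i + 2 \<le> j \<Longrightarrow> j < CARD('n) \<Longrightarrow>
    (free_gen i * free_gen j - free_gen j * free_gen i :: 'n free_skein) \<in> skein_relators"
| skein: "1 \<le> i \<Longrightarrow> i < CARD('n) \<Longrightarrow>
    (free_gen i - free_gen_inv i - free_scalar z_var :: 'n free_skein) \<in> skein_relators"

inductive_set skein_ideal :: "'n::finite free_skein set" where
  zero: "0 \<in> skein_ideal"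
| relator: "r \<in> skein_relators \<Longrightarrow> a * r * b \<in> skein_ideal"
| add: "x \<in> skein_ideal \<Longrightarrow> y \<in> skein_ideal \<Longrightarrow> x + y \<in> skein_ideal"

lemma skein_ideal_mult: "x \<in> skein_ideal \<Longrightarrow> a * x * b \<in> skein_ideal"
proof (induction rule: skein_ideal.induct)
  case zero
  show ?case by (simp add: skein_ideal.zero)
next
  case (relator r c d)
  have "a * (c * r * d) * b = (a * c) * r * (d * b)" by (simp add: mult.assoc)
  with relator show ?case by (metis skein_ideal.relator)
next
  case (add x y)
  then show ?case by (simp add: distrib_left distrib_right skein_ideal.add)
qed

lemma skein_ideal_left: "x \<in> skein_ideal \<Longrightarrow> a * x \<in> skein_ideal"
  using skein_ideal_mult[of x a 1] by simp

lemma skein_ideal_right: "x \<in> skein_ideal \<Longrightarrow> x * b \<in> skein_ideal"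
  using skein_ideal_mult[of x 1 b] by simp

lemma skein_ideal_uminus: "x \<in> skein_ideal \<Longrightarrow> - x \<in> skein_ideal"
  using skein_ideal_left[of x "- 1"] by simp

lemma skein_ideal_diff: "x \<in> skein_ideal \<Longrightarrow> y \<in> skein_ideal \<Longrightarrow> x - y \<in> skein_ideal"
  using skein_ideal.add[of x "- y"] skein_ideal_uminus[of y] by simp

section \<open>Evaluation homomorphisms\<close>

definition pm_eval :: "('c::zero \<Rightarrow> 'a::ring_1) \<Rightarrow> ('w \<Rightarrow> 'a) \<Rightarrow> ('w \<Rightarrow>\<^sub>0 'c) \<Rightarrow> 'a" where
  "pm_eval \<phi> h f = (\<Sum>w\<in>Poly_Mapping.keys f. \<phi> (Poly_Mapping.lookup f w) * h w)"

locale pm_evaluation =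
  fixes \<phi> :: "'c::ring_1 \<Rightarrow> 'a::ring_1" and h :: "'w::monoid_add \<Rightarrow> 'a"
  assumes phi_add: "\<phi> (c + d) = \<phi> c + \<phi> d"
    and phi_mult: "\<phi> (c * d) = \<phi> c * \<phi> d"
    and phi_one: "\<phi> 1 = 1"
    and phi_central: "\<phi> c * x = x * \<phi> c"
    and h_zero: "h 0 = 1"
    and h_plus: "h (u + w) = h u * h w"
begin

lemma phi_zero: "\<phi> 0 = 0"
  using phi_add[of 0 0] by simp

lemma eval_superset:
  assumes "finite S" "Poly_Mapping.keys f \<subseteq> S"
  shows "pm_eval \<phi> h f = (\<Sum>w\<in>S. \<phi> (Poly_Mapping.lookup f w) * h w)"
  unfolding pm_eval_def
  by (rule sum.mono_neutral_left) (use assms in \<open>auto simp: in_keys_iff phi_zero\<close>)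

lemma eval_zero: "pm_eval \<phi> h 0 = 0"
  by (simp add: pm_eval_def)

lemma eval_single: "pm_eval \<phi> h (Poly_Mapping.single w c) = \<phi> c * h w"
  by (simp add: pm_eval_def phi_zero)

lemma eval_add: "pm_eval \<phi> h (f + g) = pm_eval \<phi> h f + pm_eval \<phi> h g"
proof -
  let ?S = "Poly_Mapping.keys f \<union> Poly_Mapping.keys g"
  have "pm_eval \<phi> h (f + g) = (\<Sum>w\<in>?S. \<phi> (Poly_Mapping.lookup (f + g) w) * h w)"
    by (rule eval_superset) (use Poly_Mapping.keys_add[of f g] in auto)
  moreover have "pm_eval \<phi> h f = (\<Sum>w\<in>?S. \<phi> (Poly_Mapping.lookup f w) * h w)"
    by (rule eval_superset) auto
  moreover have "pm_eval \<phi> h g = (\<Sum>w\<in>?S. \<phi> (Poly_Mapping.lookup g w) * h w)"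
    by (rule eval_superset) auto
  ultimately show ?thesis
    by (simp add: lookup_add phi_add distrib_right sum.distrib)
qed

lemma eval_one: "pm_eval \<phi> h 1 = 1"
proof -
  have "pm_eval \<phi> h (Poly_Mapping.single 0 1) = \<phi> 1 * h 0" by (rule eval_single)
  then show ?thesis by (simp add: phi_one h_zero)
qed

lemma eval_uminus: "pm_eval \<phi> h (- f) = - pm_eval \<phi> h f"
  using eval_add[of f "- f"] by (simp add: eval_zero eq_neg_iff_add_eq_0 add.commute)

lemma eval_diff: "pm_eval \<phi> h (f - g) = pm_eval \<phi> h f - pm_eval \<phi> h g"
  using eval_add[of f "- g"] by (simp add: eval_uminus)

lemma eval_sum: "pm_eval \<phi> h (\<Sum>i\<in>I. f i) = (\<Sum>i\<in>I. pm_eval \<phi> h (f i))"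
  by (induction I rule: infinite_finite_induct) (simp_all add: eval_zero eval_add)

lemma eval_mult: "pm_eval \<phi> h (f * g) = pm_eval \<phi> h f * pm_eval \<phi> h g"
proof -
  have split: "p = (\<Sum>w\<in>Poly_Mapping.keys p. Poly_Mapping.single w (Poly_Mapping.lookup p w))"
    for p :: "'w \<Rightarrow>\<^sub>0 'c"
    by (rule poly_mapping_eqI)
      (auto simp: lookup_sum lookup_single when_def in_keys_iff sum.delta)
  have single: "pm_eval \<phi> h (Poly_Mapping.single u c * Poly_Mapping.single w d)
      = pm_eval \<phi> h (Poly_Mapping.single u c) * pm_eval \<phi> h (Poly_Mapping.single w d)"
    for u w c d
    by (simp add: mult_single eval_single phi_mult h_plus mult.assoc)
      (metis mult.assoc phi_central)
  have "pm_eval \<phi> h (f * g) =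
      pm_eval \<phi> h ((\<Sum>u\<in>Poly_Mapping.keys f. Poly_Mapping.single u (Poly_Mapping.lookup f u)) *
        (\<Sum>w\<in>Poly_Mapping.keys g. Poly_Mapping.single w (Poly_Mapping.lookup g w)))"
    by (simp only: split[symmetric])
  also have "\<dots> =
      pm_eval \<phi> h (\<Sum>u\<in>Poly_Mapping.keys f. Poly_Mapping.single u (Poly_Mapping.lookup f u)) *
      pm_eval \<phi> h (\<Sum>w\<in>Poly_Mapping.keys g. Poly_Mapping.single w (Poly_Mapping.lookup g w))"
    by (simp add: sum_product eval_sum single)
  also have "\<dots> = pm_eval \<phi> h f * pm_eval \<phi> h g"
    by (simp only: split[symmetric])
  finally show ?thesis .
qed

end

text \<open>A character of the skein module (\<open>v = 1\<close>, \<open>z = 3/2\<close>, all generators sent to \<open>2\<close>), which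
  shows that the quotient below is not the zero ring.\<close>

definition test_scalar :: "laurent \<Rightarrow> rat" where
  "test_scalar = pm_eval of_int (\<lambda>(a, b). (3 / 2) powi b)"

definition test_word :: "'n::finite braid_word \<Rightarrow> rat" where
  "test_word w = prod_list (map (\<lambda>(i, b). if b then 2 else 1 / 2) (letters w))"

interpretation test_scalar: pm_evaluation of_int "\<lambda>(a :: int, b). (3 / 2 :: rat) powi b"
  by standard (auto simp: power_int_add zero_prod_def)

interpretation test_hom: pm_evaluation test_scalar "test_word :: 'n::finite braid_word \<Rightarrow> rat"
  by standard
    (simp_all add: test_scalar_def test_scalar.eval_add test_scalar.eval_mult test_scalar.eval_one
      test_word_def zero_braid_word.rep_eq plus_braid_word.rep_eq mult.commute)

lemma test_letters:
  assumes "1 \<le> i" "i < CARD('n)"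
  shows "pm_eval test_scalar test_word (free_gen i :: 'n::finite free_skein) = 2"
    and "pm_eval test_scalar test_word (free_gen_inv i :: 'n free_skein) = 1 / 2"
  using assms
  by (simp_all add: free_gen_def free_gen_inv_def test_hom.eval_single test_hom.phi_one
      test_word_def letter_word.rep_eq)

lemma test_z: "pm_eval test_scalar test_word (free_scalar z_var :: 'n::finite free_skein) = 3 / 2"
  unfolding free_scalar_def test_hom.eval_single test_hom.h_zero
  unfolding z_var_def test_scalar_def test_scalar.eval_single by simp

lemma test_relator:
  "r \<in> skein_relators \<Longrightarrow> pm_eval test_scalar (test_word :: 'n::finite braid_word \<Rightarrow> rat) r = 0"
  by (induction rule: skein_relators.induct)
    (simp_all add: test_hom.eval_diff test_hom.eval_mult test_hom.eval_one test_letters test_z)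

lemma test_ideal:
  "x \<in> skein_ideal \<Longrightarrow> pm_eval test_scalar (test_word :: 'n::finite braid_word \<Rightarrow> rat) x = 0"
  by (induction rule: skein_ideal.induct)
    (simp_all add: test_hom.eval_zero test_hom.eval_mult test_hom.eval_add test_relator)

lemma one_notin_skein_ideal: "(1 :: 'n::finite free_skein) \<notin> skein_ideal"
  using test_ideal[of "1 :: 'n free_skein"] by (auto simp: test_hom.eval_one)

section \<open>The skein module of braids\<close>

definition skein_cong :: "'n::finite free_skein \<Rightarrow> 'n free_skein \<Rightarrow> bool" where
  "skein_cong x y \<longleftrightarrow> x - y \<in> skein_ideal"

lemma equivp_skein_cong: "equivp (skein_cong :: 'n::finite free_skein \<Rightarrow> _)"
proof (rule equivpI)
  let ?R = "skein_cong :: 'n free_skein \<Rightarrow> _"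
  show "reflp ?R"
    by (simp add: reflp_def skein_cong_def skein_ideal.zero)
  show "symp ?R"
    by (metis minus_diff_eq skein_cong_def skein_ideal_uminus sympI)
  show "transp ?R"
  proof (rule transpI)
    fix x y z :: "'n free_skein"
    assume "skein_cong x y" "skein_cong y z"
    then have "(x - y) + (y - z) \<in> skein_ideal"
      unfolding skein_cong_def by (rule skein_ideal.add)
    then show "skein_cong x z" by (simp add: skein_cong_def)
  qed
qed

quotient_type (overloaded) 'n skein = "('n::finite) free_skein" / skein_cong
  by (rule equivp_skein_cong)

instantiation skein :: (finite) ring_1
begin

lift_definition zero_skein :: "'a skein" is 0 .
lift_definition one_skein :: "'a skein" is 1 .

lift_definition plus_skein :: "'a skein \<Rightarrow> 'a skein \<Rightarrow> 'a skein" is "(+)"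
  unfolding skein_cong_def by (metis add_diff_add skein_ideal.add)

lift_definition uminus_skein :: "'a skein \<Rightarrow> 'a skein" is uminus
  unfolding skein_cong_def by (metis minus_diff_minus skein_ideal_uminus)

lift_definition minus_skein :: "'a skein \<Rightarrow> 'a skein \<Rightarrow> 'a skein" is "(-)"
proof -
  fix x x' y y' :: "'a free_skein"
  assume "skein_cong x x'" "skein_cong y y'"
  then have "(x - x') - (y - y') \<in> skein_ideal"
    unfolding skein_cong_def by (rule skein_ideal_diff)
  then show "skein_cong (x - y) (x' - y')"
    by (simp add: skein_cong_def algebra_simps)
qed

lift_definition times_skein :: "'a skein \<Rightarrow> 'a skein \<Rightarrow> 'a skein" is "(*)"
proof -
  fix x x' y y' :: "'a free_skein"
  assume "skein_cong x x'" "skein_cong y y'"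
  then have "(x - x') * y + x' * (y - y') \<in> skein_ideal"
    unfolding skein_cong_def
    by (intro skein_ideal.add skein_ideal_left skein_ideal_right)
  then show "skein_cong (x * y) (x' * y')"
    by (simp add: skein_cong_def algebra_simps)
qed

instance
proof
  show "(0 :: 'a skein) \<noteq> 1"
    by transfer (use one_notin_skein_ideal skein_ideal_uminus in \<open>force simp: skein_cong_def\<close>)
qed (transfer; simp add: skein_cong_def algebra_simps skein_ideal.zero)+

end

lift_definition sigma :: "nat \<Rightarrow> 'n::finite skein" is free_gen .
lift_definition sigma_inv :: "nat \<Rightarrow> 'n::finite skein" is free_gen_inv .
lift_definition scalar :: "laurent \<Rightarrow> 'n::finite skein" is free_scalar .

lemma skein_relatorI: "r \<in> skein_relators \<Longrightarrow> r \<in> skein_ideal"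
  using skein_ideal.relator[of r 1 1] by simp

lemma sigma_inverse_right:
  "1 \<le> i \<Longrightarrow> i < CARD('n) \<Longrightarrow> (sigma i * sigma_inv i :: 'n::finite skein) = 1"
  by transfer (simp add: skein_cong_def skein_relatorI skein_relators.intros)

lemma sigma_inverse_left:
  "1 \<le> i \<Longrightarrow> i < CARD('n) \<Longrightarrow> (sigma_inv i * sigma i :: 'n::finite skein) = 1"
  by transfer (simp add: skein_cong_def skein_relatorI skein_relators.intros)

lemma sigma_braid:
  "1 \<le> i \<Longrightarrow> i + 1 < CARD('n) \<Longrightarrow>
    (sigma i * sigma (i + 1) * sigma i :: 'n::finite skein) = sigma (i + 1) * sigma i * sigma (i + 1)"
  by transfer (use skein_relatorI skein_relators.braid in \<open>force simp: skein_cong_def\<close>)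

lemma sigma_commute:
  "1 \<le> i \<Longrightarrow> i + 2 \<le> j \<Longrightarrow> j < CARD('n) \<Longrightarrow>
    (sigma i * sigma j :: 'n::finite skein) = sigma j * sigma i"
  by transfer (simp add: skein_cong_def skein_relatorI skein_relators.intros)

lemma sigma_skein:
  "1 \<le> i \<Longrightarrow> i < CARD('n) \<Longrightarrow> (sigma i - sigma_inv i :: 'n::finite skein) = scalar z_var"
  by transfer (simp add: skein_cong_def skein_relatorI skein_relators.intros)

lemma scalar_add: "(scalar (c + d) :: 'n::finite skein) = scalar c + scalar d"
  by transfer (simp add: skein_cong_def free_scalar_def single_add skein_ideal.zero)

lemma scalar_mult: "(scalar (c * d) :: 'n::finite skein) = scalar c * scalar d"
  by transfer (simp add: skein_cong_def free_scalar_def mult_single skein_ideal.zero)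

lemma scalar_one: "(scalar 1 :: 'n::finite skein) = 1"
  by transfer (simp add: skein_cong_def free_scalar_def skein_ideal.zero)

lemma free_scalar_central: "free_scalar c * x = x * (free_scalar c :: 'n::finite free_skein)"
proof -
  have split: "x = (\<Sum>w\<in>Poly_Mapping.keys x. Poly_Mapping.single w (Poly_Mapping.lookup x w))"
    by (rule poly_mapping_eqI)
      (auto simp: lookup_sum lookup_single when_def in_keys_iff sum.delta)
  have "free_scalar c * (\<Sum>w\<in>Poly_Mapping.keys x. Poly_Mapping.single w (Poly_Mapping.lookup x w)) =
      (\<Sum>w\<in>Poly_Mapping.keys x. Poly_Mapping.single w (Poly_Mapping.lookup x w)) * free_scalar c"
    by (simp add: sum_distrib_left sum_distrib_right free_scalar_def mult_single mult.commute)
  then show ?thesis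
    by (simp only: split[symmetric])
qed

lemma scalar_central: "scalar c * x = x * (scalar c :: 'n::finite skein)"
  by transfer (simp add: skein_cong_def free_scalar_central skein_ideal.zero)

section \<open>Adding a strand\<close>

definition shift_word :: "nat \<Rightarrow> 'm::finite braid_word \<Rightarrow> 'n::finite skein" where
  "shift_word k w =
    prod_list (map (\<lambda>(i, b). if b then sigma (i + k) else sigma_inv (i + k)) (letters w))"

interpretation shift: pm_evaluation scalar "shift_word k :: 'm::finite braid_word \<Rightarrow> 'n::finite skein"
  for k
  by standard
    (simp_all add: scalar_add scalar_mult scalar_one shift_word_def
      zero_braid_word.rep_eq plus_braid_word.rep_eq, rule scalar_central)

lemma shift_letters:
  assumes "1 \<le> i" "i < CARD('m)"
  shows "pm_eval scalar (shift_word k) (free_gen i :: 'm::finite free_skein) =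
      (sigma (i + k) :: 'n::finite skein)"
    and "pm_eval scalar (shift_word k) (free_gen_inv i :: 'm free_skein) =
      (sigma_inv (i + k) :: 'n skein)"
  using assms
  by (simp_all add: free_gen_def free_gen_inv_def shift.eval_single scalar_one shift_word_def
      letter_word.rep_eq)

lemma shift_scalar:
  "pm_eval scalar (shift_word k) (free_scalar c :: 'm::finite free_skein) =
    (scalar c :: 'n::finite skein)"
  by (simp add: free_scalar_def shift.eval_single shift.h_zero)

lemma shift_relator:
  assumes "r \<in> skein_relators" and "CARD('m) + k \<le> CARD('n)"
  shows "pm_eval scalar (shift_word k :: 'm::finite braid_word \<Rightarrow> 'n::finite skein) r = 0"
  using assms
proof (induction rule: skein_relators.induct)
  case (braid i)
  with sigma_braid[where ?'n = 'n and i = "i + k"] show ?case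
    by (simp add: shift.eval_diff shift.eval_mult shift_letters)
next
  case (far_commute i j)
  with sigma_commute[where ?'n = 'n and i = "i + k" and j = "j + k"] show ?case
    by (simp add: shift.eval_diff shift.eval_mult shift_letters)
qed (simp_all add: shift.eval_diff shift.eval_mult shift.eval_one shift_letters shift_scalar
    sigma_inverse_right sigma_inverse_left sigma_skein)

lemma shift_cong:
  assumes "skein_cong x y" and "CARD('m) + k \<le> CARD('n)"
  shows "pm_eval scalar (shift_word k :: 'm::finite braid_word \<Rightarrow> 'n::finite skein) x =
    pm_eval scalar (shift_word k) y"
proof -
  have "pm_eval scalar (shift_word k :: 'm braid_word \<Rightarrow> 'n skein) u = 0" if "u \<in> skein_ideal" for u
    using that
    by (induction rule: skein_ideal.induct)
      (simp_all add: shift.eval_zero shift.eval_mult shift.eval_add shift_relator[OF _ assms(2)])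
  from this[of "x - y"] assms(1) show ?thesis
    by (simp add: skein_cong_def shift.eval_diff)
qed

lift_definition embed12 :: "3 skein \<Rightarrow> 4 skein" is "pm_eval scalar (shift_word 0)"
  by (erule shift_cong) simp

lift_definition embed23 :: "3 skein \<Rightarrow> 4 skein" is "pm_eval scalar (shift_word 1)"
  by (erule shift_cong) simp

lemma embed12_hom:
  "embed12 (x + y) = embed12 x + embed12 y" "embed12 (x - y) = embed12 x - embed12 y"
  "embed12 (x * y) = embed12 x * embed12 y" "embed12 1 = 1" "embed12 (scalar c) = scalar c"
  by (transfer; simp add: shift.eval_add shift.eval_diff shift.eval_mult shift.eval_one
      free_scalar_def shift.eval_single shift.h_zero)+

lemma embed23_hom:
  "embed23 (x + y) = embed23 x + embed23 y" "embed23 (x - y) = embed23 x - embed23 y"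
  "embed23 (x * y) = embed23 x * embed23 y" "embed23 1 = 1" "embed23 (scalar c) = scalar c"
  by (transfer; simp add: shift.eval_add shift.eval_diff shift.eval_mult shift.eval_one
      free_scalar_def shift.eval_single shift.h_zero)+

lemma embed12_sigma: "i \<in> {1, 2} \<Longrightarrow> embed12 (sigma i) = sigma i"
  by transfer (auto simp: free_gen_def shift.eval_single scalar_one shift_word_def letter_word.rep_eq)

lemma embed23_sigma: "i \<in> {1, 2} \<Longrightarrow> embed23 (sigma i) = sigma (i + 1)"
  by transfer (auto simp: free_gen_def shift.eval_single scalar_one shift_word_def letter_word.rep_eq)

section \<open>The positive tetrahedron equation\<close>

definition tetrahedron_eq :: "3 skein \<Rightarrow> bool" where
  "tetrahedron_eq L \<longleftrightarrow>
    embed12 L * sigma 3 * sigma 2 * sigma 1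
    + sigma 2 * sigma 1 * embed23 L * sigma 1
    + sigma 2 * sigma 3 * embed12 L * sigma 3
    + embed23 L * sigma 1 * sigma 2 * sigma 3
    - sigma 3 * sigma 2 * sigma 1 * embed23 L
    - sigma 3 * embed12 L * sigma 3 * sigma 2
    - sigma 1 * embed23 L * sigma 1 * sigma 2
    - sigma 1 * sigma 2 * sigma 3 * embed12 L = 0"

text \<open>Replacing a triple crossing by itself solves the equation tautologically: in each of the
  eight terms the inserted half twist on three strands yields the half twist on four strands.\<close>

lemma tetrahedron_eq_half_twist: "tetrahedron_eq (sigma 1 * sigma 2 * sigma 1)"
proof -
  let ?a = "sigma 1 :: 4 skein" and ?b = "sigma 2 :: 4 skein" and ?c = "sigma 3 :: 4 skein"
  have plus_one: "(1 :: nat) + 1 = 2" "(2 :: nat) + 1 = 3" by simp_all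
  have ab: "?a * (?b * ?a) = ?b * (?a * ?b)"
    using sigma_braid[of 1, where ?'n = 4] unfolding plus_one by (simp add: mult.assoc)
  have bc: "?b * (?c * ?b) = ?c * (?b * ?c)"
    using sigma_braid[of 2, where ?'n = 4] unfolding plus_one by (simp add: mult.assoc)
  have ac: "?c * ?a = ?a * ?c"
    using sigma_commute[of 1 3, where ?'n = 4] by simp
  have ab': "?a * (?b * (?a * x)) = ?b * (?a * (?b * x))" for x
    using arg_cong[OF ab, of "\<lambda>y. y * x"] by (simp only: mult.assoc)
  have bc': "?b * (?c * (?b * x)) = ?c * (?b * (?c * x))" for x
    using arg_cong[OF bc, of "\<lambda>y. y * x"] by (simp only: mult.assoc)
  have ac': "?c * (?a * x) = ?a * (?c * x)" for x
    using arg_cong[OF ac, of "\<lambda>y. y * x"] by (simp only: mult.assoc)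
  have d12: "embed12 (sigma 1 * sigma 2 * sigma 1) = ?a * ?b * ?a"
    using embed12_sigma[of 1] embed12_sigma[of 2] by (simp add: embed12_hom)
  have d23: "embed23 (sigma 1 * sigma 2 * sigma 1) = ?b * ?c * ?b"
    using embed23_sigma[of 1] embed23_sigma[of 2] unfolding plus_one by (simp add: embed23_hom)
  define D where "D = ?a * (?b * (?a * (?c * (?b * ?a))))"
  have t1: "?a * ?b * ?a * ?c * ?b * ?a = D"
    by (simp only: D_def mult.assoc)
  have t2: "?b * ?a * (?b * ?c * ?b) * ?a = D"
    by (simp only: D_def mult.assoc ab')
  have t8: "?a * ?b * ?c * (?a * ?b * ?a) = D"
    by (simp only: D_def mult.assoc ac')
  have t7: "?a * (?b * ?c * ?b) * ?a * ?b = D"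
    using t8 by (simp only: mult.assoc ab)
  have t4: "?b * ?c * ?b * ?a * ?b * ?c = D"
  proof -
    have "?b * ?c * ?b * ?a * ?b * ?c = ?b * (?c * (?a * (?b * (?a * ?c))))"
      by (simp only: mult.assoc ab')
    also have "\<dots> = ?b * (?a * (?c * (?b * (?c * ?a))))"
      by (simp only: ac' ac)
    also have "\<dots> = ?b * (?a * (?b * (?c * (?b * ?a))))"
      by (simp only: bc')
    finally show ?thesis using t2 by (simp only: mult.assoc)
  qed
  have t3: "?b * ?c * (?a * ?b * ?a) * ?c = D"
    using t4 by (simp only: mult.assoc ab')
  have t5: "?c * ?b * ?a * (?b * ?c * ?b) = D"
  proof -
    have "?c * ?b * ?a * (?b * ?c * ?b) = ?c * (?a * (?b * (?a * (?c * ?b))))"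
      by (simp only: mult.assoc ab')
    also have "\<dots> = ?a * (?c * (?b * (?c * (?a * ?b))))"
      by (simp only: ac')
    also have "\<dots> = ?a * (?b * (?c * (?b * (?a * ?b))))"
      by (simp only: bc')
    finally show ?thesis using t7 by (simp only: mult.assoc)
  qed
  have t6: "?c * (?a * ?b * ?a) * ?c * ?b = D"
    using t5 by (simp only: mult.assoc ab')
  show ?thesis
    unfolding tetrahedron_eq_def d12 d23 t1 t2 t3 t4 t5 t6 t7 t8 by simp
qed

text \<open>It is not a multiple of the difference of the two generators, so the solutions of the
  equation do not form a module of rank one.\<close>

lemma half_twist_not_multiple:
  "(sigma 1 * sigma 2 * sigma 1 :: 3 skein) \<noteq> scalar c * (sigma 2 - sigma 1)"
proof (transfer, rule notI)
  fix c
  let ?ev = "pm_eval test_scalar test_word :: 3 free_skein \<Rightarrow> rat"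
  assume "skein_cong (free_gen 1 * free_gen 2 * free_gen 1 :: 3 free_skein)
    (free_scalar c * (free_gen 2 - free_gen 1))"
  then have "?ev (free_gen 1 * free_gen 2 * free_gen 1
      - free_scalar c * (free_gen 2 - free_gen 1)) = 0"
    unfolding skein_cong_def by (rule test_ideal)
  then show False
    using test_letters(1)[of 1, where ?'n = 3] test_letters(1)[of 2, where ?'n = 3]
    by (simp add: test_hom.eval_diff test_hom.eval_mult)
qed

end

theory Submission
  imports Defs "HOL-Combinatorics.Perm"
begin

text \<open>
  \<open>H\<^sub>3\<close> is spanned by the six elements \<open>T\<^sub>w\<close>. Rewriting with the braid and quadratic relations, the left
  hand side of the equation for \<open>L = c\<^sub>0 + c\<^sub>1\<sigma>\<^sub>1 + c\<^sub>2\<sigma>\<^sub>2 + c\<^sub>3\<sigma>\<^sub>1\<sigma>\<^sub>2 + c\<^sub>4\<sigma>\<^sub>2\<sigma>\<^sub>1 + c\<^sub>5\<sigma>\<^sub>1\<sigma>\<^sub>2\<sigma>\<^sub>1\<close> is \<open>z\<close> times a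
  combination of differences of distinct \<open>T\<^sub>w\<close> in \<open>H\<^sub>4\<close> with coefficients \<open>c\<^sub>0\<close>, \<open>c\<^sub>1 + c\<^sub>2\<close>, \<open>c\<^sub>3\<close>, \<open>c\<^sub>4\<close>.
  These coefficients are read off by letting the skein algebra act on functions on permutations, and
  \<open>z\<close> is a unit.
\<close>

section \<open>The regular representation\<close>

typedef 'p laurent_endo =
  "{F :: ('p \<Rightarrow> laurent) \<Rightarrow> 'p \<Rightarrow> laurent.
    (\<forall>f g. F (\<lambda>x. f x + g x) = (\<lambda>x. F f x + F g x)) \<and>
    (\<forall>c f. F (\<lambda>x. c * f x) = (\<lambda>x. c * F f x))}"
  morphisms endo_apply Laurent_Endo
  by (intro exI[of _ "\<lambda>f. f"]) simp

setup_lifting type_definition_laurent_endo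

lemma endo_apply_scale: "endo_apply F (\<lambda>x. c * f x) = (\<lambda>x. c * endo_apply F f x)"
  using endo_apply[of F] by auto

instantiation laurent_endo :: (type) ring_1
begin

lift_definition zero_laurent_endo :: "'a laurent_endo" is "\<lambda>f x. 0" by simp

lift_definition one_laurent_endo :: "'a laurent_endo" is "\<lambda>f. f" by simp

lift_definition plus_laurent_endo :: "'a laurent_endo \<Rightarrow> 'a laurent_endo \<Rightarrow> 'a laurent_endo"
  is "\<lambda>F G f x. F f x + G f x" by (auto simp: algebra_simps)

lift_definition uminus_laurent_endo :: "'a laurent_endo \<Rightarrow> 'a laurent_endo"
  is "\<lambda>F f x. - F f x" by auto

lift_definition minus_laurent_endo :: "'a laurent_endo \<Rightarrow> 'a laurent_endo \<Rightarrow> 'a laurent_endo"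
  is "\<lambda>F G f x. F f x - G f x" by (auto simp: algebra_simps)

lift_definition times_laurent_endo :: "'a laurent_endo \<Rightarrow> 'a laurent_endo \<Rightarrow> 'a laurent_endo"
  is "\<lambda>F G f. F (G f)" by auto

instance
proof
  show "(0 :: 'a laurent_endo) \<noteq> 1"
  proof (transfer, rule notI)
    assume "(\<lambda>(f :: 'a \<Rightarrow> laurent) x. 0) = (\<lambda>f. f)"
    then have "(0 :: laurent) = 1" by (metis (full_types))
    then show False by simp
  qed
qed (transfer; simp add: algebra_simps)+

end

lemma laurent_endo_eqI:
  "(\<And>f x. endo_apply F f x = endo_apply G f x) \<Longrightarrow> F = G"
  by (rule iffD1[OF endo_apply_inject]) (simp add: fun_eq_iff)

definition endo_scalar :: "laurent \<Rightarrow> 'p laurent_endo" where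
  "endo_scalar c = Laurent_Endo (\<lambda>f x. c * f x)"

lemma endo_apply_scalar: "endo_apply (endo_scalar c) = (\<lambda>f x. c * f x)"
  unfolding endo_scalar_def by (rule Laurent_Endo_inverse) (simp add: algebra_simps)

lemmas endo_apply_simps = zero_laurent_endo.rep_eq one_laurent_endo.rep_eq
  plus_laurent_endo.rep_eq minus_laurent_endo.rep_eq times_laurent_endo.rep_eq endo_apply_scalar

section \<open>Adjacent transpositions and the Hecke operators\<close>

definition adjacent :: "nat \<Rightarrow> nat perm" where
  "adjacent i = Perm.swap i (Suc i)"

lemma apply_adjacent:
  "Perm.apply (adjacent i) j = (if j = i then Suc i else if j = Suc i then i else j)"
  by (simp add: adjacent_def)

lemma adjacent_square: "adjacent i * adjacent i = 1"
  by (rule perm_eqI) (simp add: apply_times apply_adjacent)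

text \<open>The prefix \<open>p\<close> gives the left-nested shape in which the operators build up
  their arguments, so the relation rewrites them in place.\<close>

lemma adjacent_square': "p * adjacent i * adjacent i = p"
  by (simp add: mult.assoc adjacent_square)

lemma adjacent_braid:
  "p * adjacent i * adjacent (Suc i) * adjacent i = p * adjacent (Suc i) * adjacent i * adjacent (Suc i)"
  by (rule perm_eqI) (simp add: apply_times apply_adjacent)

lemma adjacent_commute:
  "i + 2 \<le> j \<Longrightarrow> p * adjacent i * adjacent j = p * adjacent j * adjacent i"
  by (rule perm_eqI) (auto simp add: apply_times apply_adjacent)

text \<open>The transpose of right multiplication by \<open>\<sigma>\<^sub>i\<close> on the basis \<open>T\<^sub>w\<close>.\<close>

definition hecke_op :: "nat \<Rightarrow> nat perm laurent_endo" where
  "hecke_op i = Laurent_Endo (\<lambda>f w. f (w * adjacent i) +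
    (if Perm.apply w (Suc i) < Perm.apply w i then z_var * f w else 0))"

lemma endo_apply_hecke_op:
  "endo_apply (hecke_op i) = (\<lambda>f w. f (w * adjacent i) +
    (if Perm.apply w (Suc i) < Perm.apply w i then z_var * f w else 0))"
  unfolding hecke_op_def by (rule Laurent_Endo_inverse) (auto simp: algebra_simps fun_eq_iff)

text \<open>Exactly one of \<open>w\<close> and \<open>w * adjacent i\<close> has a descent at
  \<open>i\<close>, since the transposition swaps two distinct values; the two cases agree.\<close>

lemma hecke_quadratic: "hecke_op i * hecke_op i = 1 + endo_scalar z_var * hecke_op i"
proof (rule laurent_endo_eqI)
  fix f w
  have "Perm.apply w i \<noteq> Perm.apply w (Suc i)" by (simp add: apply_inj)
  then show "endo_apply (hecke_op i * hecke_op i) f w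
      = endo_apply (1 + endo_scalar z_var * hecke_op i) f w"
    by (auto simp: endo_apply_simps endo_apply_hecke_op adjacent_square'
        apply_times apply_adjacent distrib_left add_ac)
qed

lemma hecke_braid:
  "hecke_op i * hecke_op (Suc i) * hecke_op i = hecke_op (Suc i) * hecke_op i * hecke_op (Suc i)"
proof (rule laurent_endo_eqI)
  fix f w
  \<comment> \<open>The order of these three values decides every descent test on both sides. Being
    distinct, they leave only strict orders to check.\<close>
  have "Perm.apply w i \<noteq> Perm.apply w (Suc i)" "Perm.apply w i \<noteq> Perm.apply w (Suc (Suc i))"
    "Perm.apply w (Suc i) \<noteq> Perm.apply w (Suc (Suc i))" by (simp_all add: apply_inj)
  then show "endo_apply (hecke_op i * hecke_op (Suc i) * hecke_op i) f w
      = endo_apply (hecke_op (Suc i) * hecke_op i * hecke_op (Suc i)) f w"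
    by (auto simp: endo_apply_simps endo_apply_hecke_op adjacent_square'
        adjacent_braid apply_times apply_adjacent distrib_left add_ac)
qed

text \<open>Each of the two transpositions fixes the positions compared by the other, so neither
  disturbs the other's descent test.\<close>

lemma hecke_commute:
  assumes "i + 2 \<le> j"
  shows "hecke_op i * hecke_op j = hecke_op j * hecke_op i"
  using assms
  by (intro laurent_endo_eqI)
    (auto simp: endo_apply_simps endo_apply_hecke_op adjacent_commute[OF assms] apply_times
      apply_adjacent distrib_left add_ac)

section \<open>The operators as a representation of the skein algebra\<close>

text \<open>The skein relation forces the image of an inverse letter. Both inverse relators then
  reduce to the quadratic relation.\<close>

definition hecke_word :: "'n::finite braid_word \<Rightarrow> nat perm laurent_endo" where
  "hecke_word w = prod_list
    (map (\<lambda>(i, b). if b then hecke_op i else hecke_op i - endo_scalar z_var) (letters w))"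

lemma endo_scalar_hom:
  "endo_scalar (c + d) = endo_scalar c + endo_scalar d"
  "endo_scalar (c * d) = endo_scalar c * endo_scalar d"
  "endo_scalar 1 = 1"
  by (rule laurent_endo_eqI, simp add: endo_apply_simps algebra_simps)+

lemma endo_scalar_central: "endo_scalar c * F = F * endo_scalar c"
  by (rule laurent_endo_eqI) (simp add: endo_apply_simps endo_apply_scale)

interpretation hecke: pm_evaluation endo_scalar "hecke_word :: 'n::finite braid_word \<Rightarrow> _"
  by standard
    (simp_all add: endo_scalar_hom hecke_word_def zero_braid_word.rep_eq plus_braid_word.rep_eq,
      rule endo_scalar_central)

lemma hecke_letters:
  assumes "1 \<le> i" "i < CARD('n)"
  shows "pm_eval endo_scalar hecke_word (free_gen i :: 'n::finite free_skein) = hecke_op i"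
    and "pm_eval endo_scalar hecke_word (free_gen_inv i :: 'n free_skein)
      = hecke_op i - endo_scalar z_var"
  using assms
  by (simp_all add: free_gen_def free_gen_inv_def hecke.eval_single endo_scalar_hom hecke_word_def
      letter_word.rep_eq)

lemma hecke_scalar:
  "pm_eval endo_scalar hecke_word (free_scalar c :: 'n::finite free_skein) = endo_scalar c"
  by (simp add: free_scalar_def hecke.eval_single hecke.h_zero)

lemma hecke_relator:
  "r \<in> skein_relators \<Longrightarrow>
    pm_eval endo_scalar (hecke_word :: 'n::finite braid_word \<Rightarrow> _) r = 0"
proof (induction rule: skein_relators.induct)
  case (inverse_right i)
  then show ?case
    by (simp add: hecke.eval_diff hecke.eval_mult hecke.eval_one hecke_letters algebra_simps
        hecke_quadratic endo_scalar_central)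
next
  case (inverse_left i)
  then show ?case
    by (simp add: hecke.eval_diff hecke.eval_mult hecke.eval_one hecke_letters algebra_simps
        hecke_quadratic)
next
  case (braid i)
  then show ?case
    using hecke_braid[of i] by (simp add: hecke.eval_diff hecke.eval_mult hecke_letters)
next
  case (far_commute i j)
  then show ?case
    by (simp add: hecke.eval_diff hecke.eval_mult hecke_letters hecke_commute[of i j])
next
  case (skein i)
  then show ?case
    by (simp add: hecke.eval_diff hecke_letters hecke_scalar)
qed

lemma hecke_ideal:
  "x \<in> skein_ideal \<Longrightarrow> pm_eval endo_scalar (hecke_word :: 'n::finite braid_word \<Rightarrow> _) x = 0"
  by (induction rule: skein_ideal.induct)
    (simp_all add: hecke.eval_zero hecke.eval_mult hecke.eval_add hecke_relator)

lift_definition hecke_rep :: "'n::finite skein \<Rightarrow> nat perm laurent_endo"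
  is "pm_eval endo_scalar hecke_word"
proof -
  fix x y :: "'n free_skein"
  assume "skein_cong x y"
  then show "pm_eval endo_scalar hecke_word x = pm_eval endo_scalar hecke_word y"
    using hecke_ideal[of "x - y"] by (simp add: skein_cong_def hecke.eval_diff)
qed

lemma hecke_rep_hom:
  fixes x y :: "'n::finite skein"
  shows "hecke_rep (x + y) = hecke_rep x + hecke_rep y"
    and "hecke_rep (x - y) = hecke_rep x - hecke_rep y"
    and "hecke_rep (x * y) = hecke_rep x * hecke_rep y"
    and "hecke_rep (scalar c :: 'n skein) = endo_scalar c"
    and "hecke_rep (0 :: 'n skein) = 0"
  by (transfer; simp add: hecke.eval_add hecke.eval_diff hecke.eval_mult hecke_scalar
      hecke.eval_zero)+

lemma hecke_rep_sigma:
  "1 \<le> i \<Longrightarrow> i < CARD('n) \<Longrightarrow> hecke_rep (sigma i :: 'n::finite skein) = hecke_op i"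
  by transfer (simp add: hecke_letters)

text \<open>On a product of generators along a reduced word of \<open>w\<close> this functional takes the value
  \<open>f w\<close>, because no descent is met on the way from the identity to \<open>w\<close>.\<close>

definition hecke_functional :: "(nat perm \<Rightarrow> laurent) \<Rightarrow> 'n::finite skein \<Rightarrow> laurent" where
  "hecke_functional f x = endo_apply (hecke_rep x) f 1"

lemma hecke_functional_linear:
  "hecke_functional f (x + y) = hecke_functional f x + hecke_functional f y"
  "hecke_functional f (x - y) = hecke_functional f x - hecke_functional f y"
  "hecke_functional f (scalar c * x) = c * hecke_functional f x"
  "hecke_functional f 0 = 0"
  by (simp_all add: hecke_functional_def hecke_rep_hom endo_apply_simps)

section \<open>A spanning set for three strands\<close>

text \<open>The six monomials are reduced words for the elements of the symmetric group on three
  letters; values of \<open>c\<close> beyond index 5 are ignored.\<close>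

definition span3 :: "(nat \<Rightarrow> laurent) \<Rightarrow> 3 skein" where
  "span3 c = scalar (c 0) + scalar (c 1) * sigma 1 + scalar (c 2) * sigma 2
    + scalar (c 3) * (sigma 1 * sigma 2) + scalar (c 4) * (sigma 2 * sigma 1)
    + scalar (c 5) * (sigma 1 * sigma 2 * sigma 1)"

lemma sigma_inv_eq:
  assumes "1 \<le> i" "i < CARD('n)"
  shows "(sigma_inv i :: 'n::finite skein) = sigma i - scalar z_var"
  using sigma_skein[OF assms] by (simp add: algebra_simps)

lemma sigma_square:
  assumes "1 \<le> i" "i < CARD('n)"
  shows "(sigma i * sigma i :: 'n::finite skein) = 1 + scalar z_var * sigma i"
  using sigma_inverse_right[OF assms]
  by (simp add: sigma_inv_eq[OF assms] right_diff_distrib scalar_central diff_eq_eq)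

lemma scalar_left_commute:
  "x * (scalar c * y) = scalar c * (x * y :: 'n::finite skein)"
  by (metis mult.assoc scalar_central)

lemma scalar_zero: "(scalar 0 :: 'n::finite skein) = 0"
  using scalar_add[of 0 0, where ?'n = 'n] by simp

lemma span3_add: "span3 c + span3 d = span3 (\<lambda>i. c i + d i)"
  by (simp add: span3_def scalar_add algebra_simps)

lemma span3_scale: "scalar a * span3 c = span3 (\<lambda>i. a * c i)"
  by (simp add: span3_def scalar_mult algebra_simps)

lemma span3_scalar: "scalar a = span3 (\<lambda>i. if i = 0 then a else 0)"
  by (simp add: span3_def scalar_zero)

lemma sigma_span3:
  assumes "i \<in> {1, 2}"
  shows "\<exists>d. sigma i * span3 c = span3 d"
proof -
  let ?a = "sigma 1 :: 3 skein" and ?b = "sigma 2 :: 3 skein" and ?z = "scalar z_var :: 3 skein"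
  have aa: "?a * ?a = 1 + ?z * ?a" and bb: "?b * ?b = 1 + ?z * ?b"
    using sigma_square[of 1, where ?'n = 3] sigma_square[of 2, where ?'n = 3] by simp_all
  have aa': "?a * (?a * x) = x + ?z * (?a * x)" and bb': "?b * (?b * x) = x + ?z * (?b * x)" for x
    unfolding mult.assoc[symmetric] aa bb by (simp_all add: distrib_right)
  have bab: "?b * (?a * ?b) = ?a * (?b * ?a)"
    using sigma_braid[of 1, where ?'n = 3] by (simp add: mult.assoc numeral_2_eq_2)
  have bab': "?b * (?a * (?b * x)) = ?a * (?b * (?a * x))" for x
    using arg_cong[OF bab, of "\<lambda>y. y * x"] by (simp only: mult.assoc)
  note rules = span3_def scalar_zero scalar_add scalar_mult aa bb aa' bb' bab bab'
    mult.assoc distrib_left distrib_right scalar_left_commute[of "sigma i" for i]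
    scalar_central[of _ "sigma i" for i, symmetric]
  \<comment> \<open>Left multiplication by \<sigma>1 pairs the basis positions (0,1), (2,3), (4,5),
    and by \<sigma>2 the positions (0,2), (1,4), (3,5). Within a pair the shorter word goes to the
    longer one, and the longer one to the shorter plus \<open>z_var\<close> times itself.\<close>
  have "?a * span3 c = span3
    (\<lambda>k. [c 1, c 0 + c 1 * z_var, c 3, c 2 + c 3 * z_var, c 5, c 4 + c 5 * z_var] ! k)"
    by (simp add: rules add_ac del: One_nat_def)
  moreover have "?b * span3 c = span3
    (\<lambda>k. [c 2, c 4, c 0 + c 2 * z_var, c 5, c 1 + c 4 * z_var, c 3 + c 5 * z_var] ! k)"
    by (simp add: rules add_ac del: One_nat_def)
  ultimately show ?thesis using assms by (metis empty_iff insert_iff)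
qed

section \<open>Induction over words\<close>

text \<open>Every class has a representative that is a finite sum of words with coefficients, and
  each such term arises from a scalar by prepending letters.\<close>

lemma skein_induct [case_names scalar sigma sigma_inv add]:
  fixes x :: "'n::finite skein"
  assumes scal: "\<And>c. P (scalar c)"
    and sig: "\<And>i x. 1 \<le> i \<Longrightarrow> i < CARD('n) \<Longrightarrow> P x \<Longrightarrow> P (sigma i * x)"
    and inv: "\<And>i x. 1 \<le> i \<Longrightarrow> i < CARD('n) \<Longrightarrow> P x \<Longrightarrow> P (sigma_inv i * x)"
    and add: "\<And>x y. P x \<Longrightarrow> P y \<Longrightarrow> P (x + y)"
  shows "P x"
proof -
  have word: "P (abs_skein (Poly_Mapping.single (Braid_Word ls) c))"
    if "\<forall>l\<in>set ls. 1 \<le> fst l \<and> fst l < CARD('n)" for ls c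
    using that
  proof (induction ls)
    case Nil
    have "abs_skein (Poly_Mapping.single (Braid_Word [] :: 'n braid_word) c) = scalar c"
      by (simp add: scalar.abs_eq free_scalar_def zero_braid_word_def)
    then show ?case using scal by simp
  next
    case (Cons l ls)
    obtain i b where l: "l = (i, b)" by (cases l)
    have i: "1 \<le> i" "i < CARD('n)" using Cons.prems l by auto
    have "(Braid_Word (l # ls) :: 'n braid_word) = letter_word i b + Braid_Word ls"
      using Cons.prems i
      by (simp add: letters_inject[symmetric] plus_braid_word.rep_eq letter_word.rep_eq
          Braid_Word_inverse l)
    then have "Poly_Mapping.single (Braid_Word (l # ls) :: 'n braid_word) c
        = (if b then free_gen i else free_gen_inv i) * Poly_Mapping.single (Braid_Word ls) c"
      by (simp add: free_gen_def free_gen_inv_def mult_single)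
    then have "abs_skein (Poly_Mapping.single (Braid_Word (l # ls) :: 'n braid_word) c)
        = (if b then sigma i else sigma_inv i) * abs_skein (Poly_Mapping.single (Braid_Word ls) c)"
      by (simp add: sigma.abs_eq sigma_inv.abs_eq times_skein.abs_eq)
    moreover have "P (abs_skein (Poly_Mapping.single (Braid_Word ls) c))"
      using Cons by simp
    ultimately show ?case using i sig inv by simp
  qed
  have single: "P (abs_skein (Poly_Mapping.single w c))" for w c
    using word[of "letters w" c] letters[of w] by (simp add: letters_inverse)
  have "P (abs_skein f)" for f
  proof (induction f rule: update_induct)
    case const
    have "abs_skein 0 = (scalar 0 :: 'n skein)"
      by (simp add: scalar_zero zero_skein_def)
    then show ?case using scal by simp
  next
    case (update f w c)
    \<comment> \<open>The word \<open>w\<close> is not yet a key of \<open>f\<close>, so updating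
      there is the same as adding a monomial.\<close>
    have "Poly_Mapping.update w c f = Poly_Mapping.single w c + f"
      using update(1) by (intro poly_mapping_eqI)
        (auto simp: lookup_add lookup_single lookup_update in_keys_iff when_def)
    then have "abs_skein (Poly_Mapping.update w c f) = abs_skein (Poly_Mapping.single w c) + abs_skein f"
      by (simp add: plus_skein.abs_eq)
    then show ?case using update single add by simp
  qed
  then show ?thesis by (metis skein.abs_induct)
qed

text \<open>The span contains the scalars and is closed under left multiplication by generators; for
  inverses, use that \<sigma> and its inverse differ by a scalar.\<close>

lemma skein3_span: "\<exists>c. x = span3 c"
proof (induction x rule: skein_induct)
  case (scalar c)
  then show ?case using span3_scalar by blast
next
  case (sigma i x)
  then have "i \<in> {1, 2}" by auto
  then show ?case using sigma sigma_span3 by metis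
next
  case (sigma_inv i x)
  from sigma_inv.hyps have i: "i \<in> {1, 2}" by auto
  obtain c where c: "x = span3 c" using sigma_inv.IH by blast
  obtain d where "sigma i * span3 c = span3 d" using sigma_span3[OF i] by blast
  moreover have "scalar (- z_var) = - (scalar z_var :: 3 skein)"
    using scalar_add[of "- z_var" z_var, where ?'n = 3]
    by (simp add: scalar_zero eq_neg_iff_add_eq_0)
  ultimately have "sigma_inv i * x = span3 d + scalar (- z_var) * span3 c"
    using sigma_inv.hyps by (simp add: sigma_inv_eq left_diff_distrib c)
  then show ?case unfolding span3_add span3_scale by blast
next
  case (add x y)
  then show ?case using span3_add by metis
qed

section \<open>The tetrahedron equation\<close>

text \<open>Viewing the left-hand side as a linear map reduces the equation to its values on the
  spanning set.\<close>

definition tetrahedron :: "3 skein \<Rightarrow> 4 skein" where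
  "tetrahedron L =
    embed12 L * sigma 3 * sigma 2 * sigma 1
    + sigma 2 * sigma 1 * embed23 L * sigma 1
    + sigma 2 * sigma 3 * embed12 L * sigma 3
    + embed23 L * sigma 1 * sigma 2 * sigma 3
    - sigma 3 * sigma 2 * sigma 1 * embed23 L
    - sigma 3 * embed12 L * sigma 3 * sigma 2
    - sigma 1 * embed23 L * sigma 1 * sigma 2
    - sigma 1 * sigma 2 * sigma 3 * embed12 L"

lemma tetrahedron_eq_iff: "tetrahedron_eq L \<longleftrightarrow> tetrahedron L = 0"
  by (simp add: tetrahedron_eq_def tetrahedron_def)

lemma tetrahedron_add: "tetrahedron (x + y) = tetrahedron x + tetrahedron y"
  by (simp add: tetrahedron_def embed12_hom embed23_hom distrib_left distrib_right)

lemma tetrahedron_scale: "tetrahedron (scalar c * x) = scalar c * tetrahedron x"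
  by (simp add: tetrahedron_def embed12_hom embed23_hom distrib_left right_diff_distrib
      mult.assoc scalar_left_commute)

text \<open>The equal values on \<sigma>1 and \<sigma>2 are the source of the solution \<sigma>2 -
  \<sigma>1.\<close>

lemma tetrahedron_basis:
  defines "Z \<equiv> scalar z_var :: 4 skein" and "a \<equiv> sigma 1" and "b \<equiv> sigma 2" and "c \<equiv> sigma 3"
  shows "tetrahedron 1 = Z * (b * a + b * c - c * b - a * b)"
    and "tetrahedron (sigma 1) = Z * (b * (a * c) - a * (c * b))"
    and "tetrahedron (sigma 2) = Z * (b * (a * c) - a * (c * b))"
    and "tetrahedron (sigma 1 * sigma 2) = Z * (a * (b * (a * c)) - a * (b * (c * b)))"
    and "tetrahedron (sigma 2 * sigma 1) = Z * (b * (c * (b * a)) - a * (c * (b * a)))"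
proof -
  have aa: "a * a = 1 + Z * a" and bb: "b * b = 1 + Z * b" and cc: "c * c = 1 + Z * c"
    using sigma_square[of 1, where ?'n = 4] sigma_square[of 2, where ?'n = 4]
      sigma_square[of 3, where ?'n = 4] by (simp_all add: a_def b_def c_def Z_def)
  have aa': "a * (a * x) = x + Z * (a * x)" and bb': "b * (b * x) = x + Z * (b * x)"
    and cc': "c * (c * x) = x + Z * (c * x)" for x
    unfolding mult.assoc[symmetric] aa bb cc by (simp_all add: distrib_right)
  have plus_one: "(1 :: nat) + 1 = 2" "(2 :: nat) + 1 = 3" by simp_all
  have aba: "b * (a * b) = a * (b * a)"
    using sigma_braid[of 1, where ?'n = 4] unfolding plus_one
    by (simp add: mult.assoc a_def b_def)
  have cbc: "c * (b * c) = b * (c * b)"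
    using sigma_braid[of 2, where ?'n = 4] unfolding plus_one
    by (simp add: mult.assoc b_def c_def)
  have ca: "c * a = a * c"
    using sigma_commute[of 1 3, where ?'n = 4] by (simp add: a_def c_def)
  have aba': "b * (a * (b * x)) = a * (b * (a * x))" for x
    using arg_cong[OF aba, of "\<lambda>y. y * x"] by (simp only: mult.assoc)
  have cbc': "c * (b * (c * x)) = b * (c * (b * x))" for x
    using arg_cong[OF cbc, of "\<lambda>y. y * x"] by (simp only: mult.assoc)
  have ca': "c * (a * x) = a * (c * x)" for x
    using arg_cong[OF ca, of "\<lambda>y. y * x"] by (simp only: mult.assoc)
  \<comment> \<open>A critical pair: sorting \<open>c * a\<close> into \<open>a * c\<close> hides
    the factor \<open>c * b * c\<close> from the braid rule, so this consequence is added as a rule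
    of its own.\<close>
  have cbac: "c * (b * (a * c)) = b * (c * (b * a))"
    by (simp only: ca[symmetric] cbc')
  have cbac': "c * (b * (a * (c * x))) = b * (c * (b * (a * x)))" for x
    using arg_cong[OF cbac, of "\<lambda>y. y * x"] by (simp only: mult.assoc)
  have Z: "x * Z = Z * x" "x * (Z * y) = Z * (x * y)" if "x \<in> {a, b, c}" for x y
    unfolding Z_def by (rule scalar_central[symmetric], rule scalar_left_commute)
  have emb: "embed12 (sigma 1) = a" "embed12 (sigma 2) = b"
    "embed23 (sigma 1) = b" "embed23 (sigma 2) = c"
    using embed12_sigma[of 1] embed12_sigma[of 2] embed23_sigma[of 1] embed23_sigma[of 2]
    unfolding plus_one by (simp_all add: a_def b_def c_def)
  note rules = tetrahedron_def embed12_hom embed23_hom emb a_def[symmetric] b_def[symmetric]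
    c_def[symmetric] mult.assoc aa bb cc aa' bb' cc' aba aba' cbc cbc' ca ca' cbac cbac' Z
    distrib_left distrib_right right_diff_distrib
  show "tetrahedron 1 = Z * (b * a + b * c - c * b - a * b)"
    by (simp add: rules del: One_nat_def)
  show "tetrahedron (sigma 1) = Z * (b * (a * c) - a * (c * b))"
    by (simp add: rules del: One_nat_def)
  show "tetrahedron (sigma 2) = Z * (b * (a * c) - a * (c * b))"
    by (simp add: rules del: One_nat_def)
  show "tetrahedron (sigma 1 * sigma 2) = Z * (a * (b * (a * c)) - a * (b * (c * b)))"
    by (simp add: rules del: One_nat_def)
  show "tetrahedron (sigma 2 * sigma 1) = Z * (b * (c * (b * a)) - a * (c * (b * a)))"
    by (simp add: rules del: One_nat_def)
qed

text \<open>The coefficient \<open>c 5\<close> drops out because the half twist is a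
  solution.\<close>

lemma tetrahedron_span3:
  "tetrahedron (span3 c) = scalar z_var *
    (scalar (c 0) * (sigma 2 * sigma 1 + sigma 2 * sigma 3 - sigma 3 * sigma 2 - sigma 1 * sigma 2)
    + scalar (c 1 + c 2) * (sigma 2 * (sigma 1 * sigma 3) - sigma 1 * (sigma 3 * sigma 2))
    + scalar (c 3) * (sigma 1 * (sigma 2 * (sigma 1 * sigma 3))
        - sigma 1 * (sigma 2 * (sigma 3 * sigma 2)))
    + scalar (c 4) * (sigma 2 * (sigma 3 * (sigma 2 * sigma 1))
        - sigma 1 * (sigma 3 * (sigma 2 * sigma 1))))"
proof -
  have "tetrahedron (sigma 1 * sigma 2 * sigma 1) = 0"
    using tetrahedron_eq_half_twist tetrahedron_eq_iff by blast
  moreover have "tetrahedron (scalar (c 0)) = scalar (c 0) * tetrahedron 1"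
    using tetrahedron_scale[of _ 1] by simp
  ultimately show ?thesis
    unfolding span3_def tetrahedron_add tetrahedron_scale tetrahedron_basis
    by (simp add: distrib_left distrib_right scalar_add scalar_left_commute[of "scalar z_var"]
        del: One_nat_def)
qed

section \<open>Reading off the coefficients\<close>

definition perm_indicator :: "nat list \<Rightarrow> nat perm \<Rightarrow> laurent" where
  "perm_indicator xs w = of_bool (map (Perm.apply w) [1, 2, 3, 4] = xs)"

text \<open>Multiply by the inverse monomial: \<open>z_var\<close> is a unit of the Laurent
  ring.\<close>

lemma z_var_cancel:
  assumes "z_var * x = 0"
  shows "x = 0"
proof -
  have "x = Poly_Mapping.single (0, - 1) 1 * z_var * x"
    by (simp add: z_var_def mult_single zero_prod_def[symmetric])
  then show ?thesis
    by (simp add: mult.assoc assms)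
qed

lemma tetrahedron_span3_zeroD:
  assumes "tetrahedron (span3 c) = 0"
  shows "c 0 = 0" "c 1 + c 2 = 0" "c 3 = 0" "c 4 = 0"
proof -
  have zero: "hecke_functional f (tetrahedron (span3 c)) = 0" for f
    by (simp add: assms hecke_functional_linear)
  have rep: "hecke_rep (sigma 1 :: 4 skein) = hecke_op 1"
    "hecke_rep (sigma 2 :: 4 skein) = hecke_op 2" "hecke_rep (sigma 3 :: 4 skein) = hecke_op 3"
    by (simp_all add: hecke_rep_sigma)
  note word = hecke_functional_def hecke_rep_hom rep endo_apply_simps endo_apply_hecke_op
    perm_indicator_def apply_times apply_adjacent
  note vanish = zero[unfolded tetrahedron_span3 hecke_functional_linear]
  \<comment> \<open>Each list is the one-line notation of the first word in the matching bracket: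
    \<sigma>2\<sigma>1, \<sigma>2\<sigma>1\<sigma>3, \<sigma>1\<sigma>2\<sigma>1\<sigma>3 and
    \<sigma>2\<sigma>3\<sigma>2\<sigma>1. All words present are reduced and represent distinct
    permutations, so only that one contributes.\<close>
  show "c 0 = 0"
    by (rule z_var_cancel)
      (use vanish[of "perm_indicator [3, 1, 2, 4]"] in \<open>simp add: word del: One_nat_def\<close>)
  show "c 1 + c 2 = 0"
    by (rule z_var_cancel)
      (use vanish[of "perm_indicator [3, 1, 4, 2]"] in \<open>simp add: word del: One_nat_def\<close>)
  show "c 3 = 0"
    by (rule z_var_cancel)
      (use vanish[of "perm_indicator [3, 2, 4, 1]"] in \<open>simp add: word del: One_nat_def\<close>)
  show "c 4 = 0"
    by (rule z_var_cancel)
      (use vanish[of "perm_indicator [4, 1, 3, 2]"] in \<open>simp add: word del: One_nat_def\<close>)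
qed

text \<open>The half twist is the tautological second solution, so the solutions form a free module
  of rank two. Uniqueness of \<sigma>2 - \<sigma>1 up to a factor holds modulo multiples of the half
  twist.\<close>

theorem proposition1:
  shows "(\<forall>c d. scalar c * (sigma 2 - sigma 1)
        + scalar d * (sigma 1 * sigma 2 * sigma 1) = (0 :: 3 skein) \<longrightarrow> c = 0 \<and> d = 0) \<and>
    (\<forall>L. tetrahedron_eq L \<longleftrightarrow>
      (\<exists>c d. L = scalar c * (sigma 2 - sigma 1)
        + scalar d * (sigma 1 * sigma 2 * sigma 1)))"
proof (intro conjI allI impI iffI)
  fix c d
  assume *: "scalar c * (sigma 2 - sigma 1) + scalar d * (sigma 1 * sigma 2 * sigma 1)
    = (0 :: 3 skein)"
  have zero: "hecke_functional f
      (scalar c * (sigma 2 - sigma 1) + scalar d * (sigma 1 * sigma 2 * sigma 1) :: 3 skein) = 0"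
    for f by (simp only: * hecke_functional_linear)
  have rep: "hecke_rep (sigma 1 :: 3 skein) = hecke_op 1"
    "hecke_rep (sigma 2 :: 3 skein) = hecke_op 2"
    by (simp_all add: hecke_rep_sigma)
  note word = hecke_functional_def hecke_rep_hom rep endo_apply_simps endo_apply_hecke_op
    perm_indicator_def apply_times apply_adjacent
  note vanish = zero[unfolded hecke_functional_linear]
  \<comment> \<open>The two lists stand for \<sigma>2 and the half twist, which each occur in just
    one of the two summands.\<close>
  show "c = 0"
    using vanish[of "perm_indicator [1, 3, 2, 4]"] by (simp add: word del: One_nat_def)
  show "d = 0"
    using vanish[of "perm_indicator [3, 2, 1, 4]"] by (simp add: word del: One_nat_def)
next
  fix L
  assume "tetrahedron_eq L"
  then have "tetrahedron L = 0" by (simp add: tetrahedron_eq_iff)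
  moreover obtain c where L: "L = span3 c" using skein3_span by blast
  ultimately have c: "c 0 = 0" "c 1 + c 2 = 0" "c 3 = 0" "c 4 = 0"
    using tetrahedron_span3_zeroD by blast+
  then have "scalar (c 1) = - (scalar (c 2) :: 3 skein)"
    by (metis eq_neg_iff_add_eq_0 scalar_add scalar_zero)
  with c have "L = scalar (c 2) * (sigma 2 - sigma 1) + scalar (c 5) * (sigma 1 * sigma 2 * sigma 1)"
    by (simp add: L span3_def scalar_zero right_diff_distrib)
  then show "\<exists>c d. L = scalar c * (sigma 2 - sigma 1) + scalar d * (sigma 1 * sigma 2 * sigma 1)"
    by blast
next
  fix L :: "3 skein"
  assume "\<exists>c d. L = scalar c * (sigma 2 - sigma 1) + scalar d * (sigma 1 * sigma 2 * sigma 1)"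
  then obtain c d where L: "L = scalar c * (sigma 2 - sigma 1)
    + scalar d * (sigma 1 * sigma 2 * sigma 1)" by blast
  \<comment> \<open>By additivity this value plus that at \<sigma>1 is the value at \<sigma>2, and
    the latter two coincide.\<close>
  have "tetrahedron (sigma 2 - sigma 1) = 0"
    using tetrahedron_add[of "sigma 2 - sigma 1" "sigma 1"]
    unfolding diff_add_cancel tetrahedron_basis by simp
  then show "tetrahedron_eq L"
    using tetrahedron_eq_half_twist by (simp add: tetrahedron_eq_iff L tetrahedron_add tetrahedron_scale)
qed

end
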